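(* Assume that $g$ and $\varphi$ are Lipschitz continuous and let $L_G$ be the Lipschitz constant of $G$. Let $\Phi(u)=g(u,0,\varphi(u,0))$ for $u\in\mathbb{R}$, let $(\alpha,\beta)\subseteq\mathbb{R}$ be a bounded open interval such that $\Phi(\alpha)\cdot\Phi(\beta)<0$, and let $\Omega\subseteq[0,\infty)\times C^1_T(\mathbb{R})$ be open with $\widetilde\Omega=(\alpha,\beta)$. Let $X$ be the set of $T$-forced pairs of $$\ddot x(t)=g\Big(x(t),\dot x(t),\int_{-\infty}^t\gamma_a^b(t-s)\,\varphi(x(s),\dot x(s))\,ds\Big)+\lambda f\big(t,x(t),\dot x(t)\big),$$ and let $\Gamma\subseteq X\cap\Omega$ be a connected set of nontrivial $T$-forced pairs whose closure relative to $\Omega$ is not compact and intersects $\{(0,\overline{u})\in\Omega : u\in(\alpha,\beta)\cap\Phi^{-1}(0)\}$. If the period $T$ of the forcing term $f$ satisfies $T<2\pi/L_G$, then $\Gamma$ does not intersect the slice $\{0\}\times C^1_T(\mathbb{R})$.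
   Context: Let $a>0$, $b\in\mathbb{N}\setminus\{0\}$, $T>0$. Here $g\colon\mathbb{R}^3\to\mathbb{R}$, $\varphi\colon\mathbb{R}^2\to\mathbb{R}$, and $f\colon\mathbb{R}^3\to\mathbb{R}$ is continuous and $T$-periodic in its first variable; $\lambda\ge0$ is a parameter. The gamma probability density $\gamma_a^b$ is $$\gamma_a^b(s)=\frac{a^b s^{b-1}e^{-as}}{(b-1)!}\ \text{ for } s\ge 0,\qquad \gamma_a^b(s)=0\ \text{ for } s<0.$$ The map $G\colon\mathbb{R}^{b+2}\to\mathbb{R}^{b+2}$ is $$G(u,v_0,v_1,\ldots,v_b)=\big(v_0,\;g(u,v_0,v_b),\;a(\varphi(u,v_0)-v_1),\;a(v_1-v_2),\ldots,a(v_{b-1}-v_b)\big);$$ it is Lipschitz when $g$ and $\varphi$ are, and its Lipschitz constant is taken with respect to the Euclidean norm. $C^1_T(\mathbb{R})$ is the Banach space of $T$-periodic $C^1$ functions $x\colon\mathbb{R}\to\mathbb{R}$ with norm $\max|x|+\max|\dot x|$. For $u\in\mathbb{R}$, $\overline{u}$ denotes the constant function $t\mapsto u$. For $\Omega\subseteq[0,\infty)\times C^1_T(\mathbb{R})$ open, $\widetilde\Omega:=\{u\in\mathbb{R}:(0,\overline{u})\in\Omega\}$. A $T$-periodic solution of the equation (for a given $\lambda\ge0$) is a $C^2$ function $x\colon\mathbb{R}\to\mathbb{R}$ of period $T$ satisfying it identically on $\mathbb{R}$. A $T$-forced pair is a pair $(\lambda,x)\in[0,\infty)\times C^1_T(\mathbb{R})$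 with $x$ a $T$-periodic solution of the equation corresponding to $\lambda$. A $T$-forced pair is trivial if it is of the form $(0,x)$ with $x$ constant, and nontrivial otherwise. *)

theory Defs
  imports "HOL-Analysis.Analysis" "HOL-Probability.Probability"
begin

subsection \<open>The space of periodic continuously differentiable functions\<close>

definition C1_T :: "real \<Rightarrow> (real \<Rightarrow> real) set" where
  "C1_T T = {x. x C1_differentiable_on UNIV \<and> (\<forall>t. x (t + T) = x t)}"

text \<open>On \<open>C1_T T\<close> with \<open>T > 0\<close> both suprema are maxima.\<close>

definition C1_norm :: "(real \<Rightarrow> real) \<Rightarrow> real" where
  "C1_norm x = (SUP t. \<bar>x t\<bar>) + (SUP t. \<bar>deriv x t\<bar>)"

text \<open>The locale \<open>Metric_space\<close> asks for nonnegativity and symmetry outside the carrier as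
  well, hence the value 0 there.\<close>

definition C1_dist :: "real \<Rightarrow> (real \<Rightarrow> real) \<Rightarrow> (real \<Rightarrow> real) \<Rightarrow> real" where
  "C1_dist T x y = (if x \<in> C1_T T \<and> y \<in> C1_T T then C1_norm (\<lambda>t. x t - y t) else 0)"

definition C1_topology :: "real \<Rightarrow> (real \<Rightarrow> real) topology" where
  "C1_topology T = Metric_space.mtopology (C1_T T) (C1_dist T)"

definition pair_topology :: "real \<Rightarrow> (real \<times> (real \<Rightarrow> real)) topology" where
  "pair_topology T = prod_topology (top_of_set {0..}) (C1_topology T)"

lemma periodic_bounded_real:
  fixes x :: "real \<Rightarrow> real"
  assumes T: "T > 0" and c: "continuous_on UNIV x" and p: "\<And>t. x (t + T) = x t"
  shows "bdd_above (range (\<lambda>t. \<bar>x t\<bar>))"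
proof -
  have *: "x (t + of_int k * T) = x t" for t and k :: int
  proof -
    have n: "x (t + of_nat n * T) = x t" for t and n :: nat
    proof (induction n)
      case (Suc n)
      have "x (t + of_nat (Suc n) * T) = x ((t + of_nat n * T) + T)"
        by (simp add: algebra_simps)
      then show ?case using p Suc by simp
    qed simp
    show ?thesis
    proof (cases "k \<ge> 0")
      case True then show ?thesis using n[of t "nat k"] by simp
    next
      case False
      then show ?thesis using n[of "t + of_int k * T" "nat (- k)"] by (simp add: algebra_simps)
    qed
  qed
  have "compact ((\<lambda>t. \<bar>x t\<bar>) ` {0..T})"
    by (intro compact_continuous_image continuous_intros continuous_on_subset[OF c]) auto
  moreover have "range (\<lambda>t. \<bar>x t\<bar>) \<subseteq> (\<lambda>t. \<bar>x t\<bar>) ` {0..T}"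
  proof clarify
    fix t :: real
    define k where "k = \<lfloor>t / T\<rfloor>"
    have "of_int k \<le> t / T" "t / T < of_int k + 1" unfolding k_def by linarith+
    then have "t + of_int (- k) * T \<in> {0..T}" using T by (auto simp: field_simps)
    moreover have "x t = x (t + of_int (- k) * T)" using * by metis
    ultimately show "\<bar>x t\<bar> \<in> (\<lambda>t. \<bar>x t\<bar>) ` {0..T}" by (metis imageI)
  qed
  ultimately show ?thesis
    by (meson bdd_above_mono bounded_imp_bdd_above compact_imp_bounded)
qed

lemma C1_T_D:
  assumes "x \<in> C1_T T"
  shows "\<And>t. (x has_real_derivative deriv x t) (at t)" "continuous_on UNIV x"
    "continuous_on UNIV (deriv x)" "\<And>t. x (t + T) = x t" "\<And>t. deriv x (t + T) = deriv x t"
proof -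
  from assms obtain D where D: "\<And>t. (x has_real_derivative D t) (at t)"
    and cD: "continuous_on UNIV D" and p: "\<And>t. x (t + T) = x t"
    unfolding C1_T_def C1_differentiable_on_def has_real_derivative_iff_has_vector_derivative
    by auto
  have DD: "deriv x = D" using D by (auto intro!: DERIV_imp_deriv)
  show d: "\<And>t. (x has_real_derivative deriv x t) (at t)" using D DD by simp
  show "continuous_on UNIV x"
    using D by (meson DERIV_isCont continuous_at_imp_continuous_on)
  show "continuous_on UNIV (deriv x)" using cD DD by simp
  show "\<And>t. x (t + T) = x t" by (fact p)
  show "deriv x (t + T) = deriv x t" for t
  proof -
    have "((\<lambda>s. x (s + T)) has_real_derivative deriv x (t + T)) (at t)"
      using d[of "t + T"] DERIV_shift by blast
    moreover have "(\<lambda>s. x (s + T)) = x" using p by auto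
    ultimately show ?thesis using d[of t] DERIV_unique by metis
  qed
qed

lemma C1_T_diff:
  assumes "x \<in> C1_T T" "y \<in> C1_T T"
  shows "(\<lambda>t. x t - y t) \<in> C1_T T" "deriv (\<lambda>t. x t - y t) = (\<lambda>t. deriv x t - deriv y t)"
proof -
  show "(\<lambda>t. x t - y t) \<in> C1_T T" using assms unfolding C1_T_def by auto
  show "deriv (\<lambda>t. x t - y t) = (\<lambda>t. deriv x t - deriv y t)"
    by (rule ext, rule DERIV_imp_deriv, intro DERIV_diff C1_T_D(1)[OF assms(1)]
        C1_T_D(1)[OF assms(2)])
qed

lemma C1_T_bdd:
  assumes "T > 0" "x \<in> C1_T T"
  shows "bdd_above (range (\<lambda>t. \<bar>x t\<bar>))" "bdd_above (range (\<lambda>t. \<bar>deriv x t\<bar>))"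
  by (rule periodic_bounded_real[OF assms(1)]; rule C1_T_D[OF assms(2)])+

lemma Sup_abs_bounds:
  fixes h :: "real \<Rightarrow> real"
  assumes "bdd_above (range (\<lambda>t. \<bar>h t\<bar>))"
  shows "\<bar>h s\<bar> \<le> (SUP t. \<bar>h t\<bar>)" "0 \<le> (SUP t. \<bar>h t\<bar>)"
proof -
  show *: "\<bar>h s\<bar> \<le> (SUP t. \<bar>h t\<bar>)" for s using assms by (rule cSUP_upper[rotated]) simp
  show "0 \<le> (SUP t. \<bar>h t\<bar>)" using *[of 0] by linarith
qed

lemma Metric_space_C1_T:
  assumes T: "T > 0"
  shows "Metric_space (C1_T T) (C1_dist T)"
proof
  note bd = C1_T_bdd[OF T]
  show "0 \<le> C1_dist T x y" for x y
    unfolding C1_dist_def C1_norm_def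
    using Sup_abs_bounds(2)[OF bd(1)[OF C1_T_diff(1)]]
      Sup_abs_bounds(2)[OF bd(2)[OF C1_T_diff(1)]] by (auto intro!: add_nonneg_nonneg)
  show "C1_dist T x y = C1_dist T y x" for x y
    unfolding C1_dist_def C1_norm_def using C1_T_diff(2)[of x T y] C1_T_diff(2)[of y T x]
    by (auto simp: abs_minus_commute)
  show "C1_dist T x y = 0 \<longleftrightarrow> x = y" if xy: "x \<in> C1_T T" "y \<in> C1_T T" for x y
  proof
    note D = C1_T_diff(1)[OF xy]
    assume "C1_dist T x y = 0"
    then have "(SUP t. \<bar>x t - y t\<bar>) = 0"
      using xy Sup_abs_bounds(2)[OF bd(1)[OF D]] Sup_abs_bounds(2)[OF bd(2)[OF D]]
      unfolding C1_dist_def C1_norm_def by simp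
    then show "x = y" using Sup_abs_bounds(1)[OF bd(1)[OF D]] by fastforce
  next
    assume "x = y"
    then show "C1_dist T x y = 0" using xy by (simp add: C1_dist_def C1_norm_def)
  qed
  show "C1_dist T x z \<le> C1_dist T x y + C1_dist T y z"
    if xyz: "x \<in> C1_T T" "y \<in> C1_T T" "z \<in> C1_T T" for x y z
  proof -
    note D1 = C1_T_diff[OF xyz(1,2)] and D2 = C1_T_diff[OF xyz(2,3)] and D3 = C1_T_diff[OF xyz(1,3)]
    have "\<bar>x t - z t\<bar> \<le> (SUP t. \<bar>x t - y t\<bar>) + (SUP t. \<bar>y t - z t\<bar>)" for t
      using Sup_abs_bounds(1)[OF bd(1)[OF D1(1)], of t] Sup_abs_bounds(1)[OF bd(1)[OF D2(1)], of t]
      by linarith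
    then have 1: "(SUP t. \<bar>x t - z t\<bar>) \<le> (SUP t. \<bar>x t - y t\<bar>) + (SUP t. \<bar>y t - z t\<bar>)"
      by (intro cSUP_least) auto
    have "\<bar>deriv x t - deriv z t\<bar>
        \<le> (SUP t. \<bar>deriv x t - deriv y t\<bar>) + (SUP t. \<bar>deriv y t - deriv z t\<bar>)" for t
      using Sup_abs_bounds(1)[OF bd(2)[OF D1(1)], of t] Sup_abs_bounds(1)[OF bd(2)[OF D2(1)], of t]
      unfolding D1(2) D2(2) by linarith
    then have 2: "(SUP t. \<bar>deriv x t - deriv z t\<bar>)
        \<le> (SUP t. \<bar>deriv x t - deriv y t\<bar>) + (SUP t. \<bar>deriv y t - deriv z t\<bar>)"
      by (intro cSUP_least) auto
    show ?thesis using xyz 1 2 unfolding C1_dist_def C1_norm_def by (simp add: D1(2) D2(2) D3(2))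
  qed
qed

lemma topspace_pair_topology: "T > 0 \<Longrightarrow> topspace (pair_topology T) = {0..} \<times> C1_T T"
  by (simp add: pair_topology_def C1_topology_def Metric_space.topspace_mtopology Metric_space_C1_T)

definition slice0 :: "(real \<times> (real \<Rightarrow> real)) set \<Rightarrow> real set" where
  "slice0 \<Omega> = {u. (0, \<lambda>t. u) \<in> \<Omega>}"


subsection \<open>The equation and its forced pairs\<close>

definition gamma_density :: "real \<Rightarrow> nat \<Rightarrow> real \<Rightarrow> real" where
  "gamma_density a b s = (if s < 0 then 0 else a ^ b * s ^ (b - 1) * exp (- a * s) / fact (b - 1))"

lemma gamma_density_eq_erlang: "b \<ge> 1 \<Longrightarrow> gamma_density a b = erlang_density (b - 1) a"
  by (cases b) (auto simp: gamma_density_def erlang_density_def fun_eq_iff)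

definition periodic_solution ::
  "real \<Rightarrow> nat \<Rightarrow> (real \<times> real \<times> real \<Rightarrow> real) \<Rightarrow> (real \<times> real \<Rightarrow> real) \<Rightarrow>
   (real \<times> real \<times> real \<Rightarrow> real) \<Rightarrow> real \<Rightarrow> real \<Rightarrow> (real \<Rightarrow> real) \<Rightarrow> bool" where
  "periodic_solution a b g \<phi> f T lam x \<longleftrightarrow>
     x C1_differentiable_on UNIV \<and> deriv x C1_differentiable_on UNIV \<and>
     (\<forall>t. x (t + T) = x t) \<and>
     (\<forall>t. deriv (deriv x) t =
        g (x t, deriv x t, LINT s:{..t}|lborel. gamma_density a b (t - s) * \<phi> (x s, deriv x s))
        + lam * f (t, x t, deriv x t))"

definition forced_pairs ::
  "real \<Rightarrow> nat \<Rightarrow> (real \<times> real \<times> real \<Rightarrow> real) \<Rightarrow> (real \<times> real \<Rightarrow> real) \<Rightarrow>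
   (real \<times> real \<times> real \<Rightarrow> real) \<Rightarrow> real \<Rightarrow> (real \<times> (real \<Rightarrow> real)) set" where
  "forced_pairs a b g \<phi> f T =
     {(lam, x). 0 \<le> lam \<and> x \<in> C1_T T \<and> periodic_solution a b g \<phi> f T lam x}"

definition trivial_pair :: "real \<times> (real \<Rightarrow> real) \<Rightarrow> bool" where
  "trivial_pair p \<longleftrightarrow> (\<exists>u. p = (0, \<lambda>t. u))"


subsection \<open>The vector field \<open>G\<close> and its Lipschitz constant\<close>

text \<open>A vector \<open>(u, v\<^sub>0, v\<^sub>1, \<dots>, v\<^sub>b)\<close> of dimension \<open>b + 2\<close> is a function \<open>w\<close> on the naturals,
  read on \<open>{..<b + 2}\<close> only: \<open>u = w 0\<close> and \<open>v\<^sub>i = w (i + 1)\<close>.\<close>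

definition G_map ::
  "real \<Rightarrow> nat \<Rightarrow> (real \<times> real \<times> real \<Rightarrow> real) \<Rightarrow> (real \<times> real \<Rightarrow> real) \<Rightarrow>
   (nat \<Rightarrow> real) \<Rightarrow> nat \<Rightarrow> real" where
  "G_map a b g \<phi> w i =
     (if i = 0 then w 1
      else if i = 1 then g (w 0, w 1, w (b + 1))
      else if i = 2 then a * (\<phi> (w 0, w 1) - w 2)
      else a * (w (i - 1) - w i))"

definition Lipschitz_bound :: "nat \<Rightarrow> ((nat \<Rightarrow> real) \<Rightarrow> nat \<Rightarrow> real) \<Rightarrow> real \<Rightarrow> bool" where
  "Lipschitz_bound n F L \<longleftrightarrow> 0 \<le> L \<and>
     (\<forall>v w. L2_set (\<lambda>i. F v i - F w i) {..<n} \<le> L * L2_set (\<lambda>i. v i - w i) {..<n})"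

text \<open>The smallest Lipschitz constant with respect to the Euclidean norm (\<open>L2_set\<close>).\<close>

definition Lipschitz_constant :: "nat \<Rightarrow> ((nat \<Rightarrow> real) \<Rightarrow> nat \<Rightarrow> real) \<Rightarrow> real" where
  "Lipschitz_constant n F = Inf {L. Lipschitz_bound n F L}"

lemma G_map_Lipschitz:
  assumes g: "\<exists>C. C-lipschitz_on UNIV g" and p: "\<exists>C. C-lipschitz_on UNIV \<phi>"
  shows "\<exists>L. Lipschitz_bound (b + 2) (G_map a b g \<phi>) L"
proof -
  obtain C where C: "C-lipschitz_on UNIV g" using g by blast
  obtain K where K: "K-lipschitz_on UNIV \<phi>" using p by blast
  have C0: "C \<ge> 0" "K \<ge> 0" using C K lipschitz_on_nonneg by auto
  define M where "M = 1 + 3 * C + \<bar>a\<bar> * (2 * K + 2)"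
  have M0: "M \<ge> 0" unfolding M_def using C0 by simp
  have "L2_set (\<lambda>i. G_map a b g \<phi> v i - G_map a b g \<phi> w i) {..<b + 2}
      \<le> (of_nat (b + 2) * M) * L2_set (\<lambda>i. v i - w i) {..<b + 2}" for v w
  proof -
    define N where "N = L2_set (\<lambda>i. v i - w i) {..<b + 2}"
    have N0: "N \<ge> 0" unfolding N_def by simp
    have m: "\<bar>v i - w i\<bar> \<le> N" if "i < b + 2" for i
    proof -
      have "\<bar>v i - w i\<bar> \<le> L2_set (\<lambda>i. \<bar>v i - w i\<bar>) {..<b + 2}"
        using that by (intro member_le_L2_set) auto
      then show ?thesis by (simp add: N_def L2_set_def)
    qed
    have N1: "N \<le> M * N"
      using N0 C0 unfolding M_def by (simp add: algebra_simps)
    have g3: "C * 3 * N \<le> M * N" and a3: "\<bar>a\<bar> * (2 * K + 2) * N \<le> M * N"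
      by (rule mult_right_mono; use N0 C0 in \<open>simp add: M_def\<close>)+
    have "\<bar>G_map a b g \<phi> v i - G_map a b g \<phi> w i\<bar> \<le> M * N" if i: "i < b + 2" for i
    proof -
      consider "i = 0" | "i = 1" | "i = 2" | "i > 2" by linarith
      then show ?thesis
      proof cases
        case 1
        then show ?thesis using m[of 1] N1 by (simp add: G_map_def)
      next
        case 2
        have "dist (g (v 0, v 1, v (b+1))) (g (w 0, w 1, w (b+1)))
            \<le> C * dist (v 0, v 1, v (b+1)) (w 0, w 1, w (b+1))"
          by (rule lipschitz_onD[OF C]) auto
        also have "\<dots> \<le> C * (3 * N)"
        proof (rule mult_left_mono[OF _ C0(1)])
          have "dist (v 0, v 1, v (b+1)) (w 0, w 1, w (b+1))
              \<le> dist (v 0) (w 0) + (dist (v 1) (w 1) + dist (v (b+1)) (w (b+1)))"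
            unfolding dist_Pair_Pair
            by (rule order_trans[OF sqrt_sum_squares_le_sum] add_mono | simp)+
          then show "dist (v 0, v 1, v (b+1)) (w 0, w 1, w (b+1)) \<le> 3 * N"
            using m[of 0] m[of 1] m[of "b+1"] by (simp add: dist_real_def)
        qed
        finally show ?thesis using g3 2 by (simp add: G_map_def dist_real_def)
      next
        case 3
        have "dist (\<phi> (v 0, v 1)) (\<phi> (w 0, w 1)) \<le> K * dist (v 0, v 1) (w 0, w 1)"
          by (rule lipschitz_onD[OF K]) auto
        also have "\<dots> \<le> K * (2 * N)"
        proof (rule mult_left_mono[OF _ C0(2)])
          have "dist (v 0, v 1) (w 0, w 1) \<le> dist (v 0) (w 0) + dist (v 1) (w 1)"
            unfolding dist_Pair_Pair by (rule sqrt_sum_squares_le_sum) auto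
          then show "dist (v 0, v 1) (w 0, w 1) \<le> 2 * N"
            using m[of 0] m[of 1] by (simp add: dist_real_def)
        qed
        finally have le: "\<bar>(\<phi> (v 0, v 1) - v 2) - (\<phi> (w 0, w 1) - w 2)\<bar> \<le> (2 * K + 2) * N"
          using m[of 2] i 3 N0 unfolding dist_real_def by (simp add: algebra_simps abs_le_iff)
        have "\<bar>a\<bar> * \<bar>(\<phi> (v 0, v 1) - v 2) - (\<phi> (w 0, w 1) - w 2)\<bar> \<le> M * N"
          using a3 mult_left_mono[OF le abs_ge_zero[of a]] by (simp add: mult.assoc)
        then show ?thesis
          using 3 by (simp add: G_map_def flip: abs_mult right_diff_distrib)
      next
        case 4
        have "\<bar>(v (i-1) - v i) - (w (i-1) - w i)\<bar> \<le> 2 * N"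
          using m[of i] m[of "i-1"] i by linarith
        also have "\<dots> \<le> (2 * K + 2) * N" using N0 C0 by (simp add: algebra_simps)
        finally have le: "\<bar>(v (i-1) - v i) - (w (i-1) - w i)\<bar> \<le> (2 * K + 2) * N" .
        have "\<bar>a\<bar> * \<bar>(v (i-1) - v i) - (w (i-1) - w i)\<bar> \<le> M * N"
          using a3 mult_left_mono[OF le abs_ge_zero[of a]] by (simp add: mult.assoc)
        then show ?thesis
          using 4 by (simp add: G_map_def flip: abs_mult right_diff_distrib)
      qed
    qed
    then have "(\<Sum>i<b + 2. \<bar>G_map a b g \<phi> v i - G_map a b g \<phi> w i\<bar>) \<le> of_nat (card {..<b + 2}) * (M * N)"
      by (intro sum_bounded_above) auto
    with L2_set_le_sum_abs[of "\<lambda>i. G_map a b g \<phi> v i - G_map a b g \<phi> w i" "{..<b + 2}"]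
    show ?thesis unfolding N_def[symmetric] by (simp add: mult.assoc)
  qed
  then show ?thesis unfolding Lipschitz_bound_def using M0 by (intro exI[of _ "of_nat (b + 2) * M"]) auto
qed

end

theory Submission
  imports Defs "HOL-Real_Asymp.Real_Asymp"
begin

text \<open>For \<open>\<lambda> = 0\<close> the linear chain trick turns a \<open>T\<close>-periodic solution \<open>x\<close> into a \<open>T\<close>-periodic
  solution \<open>v = (x, x', V\<^sub>1, \<dots>, V\<^sub>b)\<close> of \<open>v' = G(v)\<close>. For each \<open>h\<close> the difference
  \<open>v(t + h) - v(t)\<close> has mean zero over a period, and the norm of its derivative is at most \<open>L\<^sub>G\<close>
  times its norm. As \<open>L\<^sub>G < 2\<pi>/T\<close>, Wirtinger's inequality forces the difference to vanish, so \<open>x\<close> is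
  constant and the pair is trivial.\<close>

section \<open>Wirtinger's inequality\<close>

text \<open>Completing the square with \<open>w = \<omega> cot(\<omega>(t - p) + \<delta>)\<close>, a solution of the Riccati equation
  \<open>w' = -(\<omega>\<^sup>2 + w\<^sup>2)\<close>, gives \<open>(f\<^sup>2 w)' \<le> f'\<^sup>2 - \<omega>\<^sup>2 f\<^sup>2\<close>. The shift \<open>\<delta>\<close> keeps \<open>w\<close> regular at the end points.\<close>

lemma wirtinger_Dirichlet:
  fixes f f' :: "real \<Rightarrow> real"
  assumes "p \<le> q" "0 < \<omega>" "\<omega> * (q - p) < pi"
    and f: "\<And>t. (f has_real_derivative f' t) (at t)"
    and f': "continuous_on UNIV f'"
    and "f p = 0" "f q = 0"
  shows "\<omega>\<^sup>2 * integral {p..q} (\<lambda>t. (f t)\<^sup>2) \<le> integral {p..q} (\<lambda>t. (f' t)\<^sup>2)"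
proof -
  \<comment> \<open>Half of the slack in \<omega> * (q - p) < pi: the angle then runs through
    [\<delta>, pi - \<delta>], inside (0, pi), where the sine is positive.\<close>
  define \<delta> where "\<delta> = (pi - \<omega> * (q - p)) / 2"
  define w where "w t = \<omega> * cot (\<omega> * (t - p) + \<delta>)" for t
  have dw: "(w has_real_derivative - (\<omega>\<^sup>2 + (w t)\<^sup>2)) (at t)" if t: "t \<in> {p..q}" for t
  proof -
    let ?\<theta> = "\<omega> * (t - p) + \<delta>"
    have "0 \<le> \<omega> * (t - p)" "\<omega> * (t - p) \<le> \<omega> * (q - p)"
      using t \<open>0 < \<omega>\<close> by auto
    then have "0 < ?\<theta>" "?\<theta> < pi"
      using assms(3) unfolding \<delta>_def by argo+
    then have s: "sin ?\<theta> > 0" by (rule sin_gt_zero)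
    then have "(cot has_real_derivative - inverse ((sin ?\<theta>)\<^sup>2)) (at ?\<theta>)"
      by (intro DERIV_cot) simp
    moreover have "((\<lambda>t. \<omega> * (t - p) + \<delta>) has_real_derivative \<omega>) (at t)"
      by (auto intro!: derivative_eq_intros)
    ultimately have "((\<lambda>t. cot (\<omega> * (t - p) + \<delta>)) has_real_derivative
        - inverse ((sin ?\<theta>)\<^sup>2) * \<omega>) (at t)"
      by (rule DERIV_chain2)
    then have "(w has_real_derivative \<omega> * (- inverse ((sin ?\<theta>)\<^sup>2) * \<omega>)) (at t)"
      unfolding w_def by (rule DERIV_cmult)
    moreover have "inverse ((sin ?\<theta>)\<^sup>2) = 1 + (cot ?\<theta>)\<^sup>2"
      using s cos_squared_eq[of ?\<theta>] by (simp add: cot_def power_divide divide_simps)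
    then have "\<omega> * (- inverse ((sin ?\<theta>)\<^sup>2) * \<omega>) = - (\<omega>\<^sup>2 + (w t)\<^sup>2)"
      by (simp only: w_def) (simp add: power2_eq_square algebra_simps)
    ultimately show ?thesis by simp
  qed
  let ?d = "\<lambda>t. 2 * f t * f' t * w t - (f t)\<^sup>2 * (\<omega>\<^sup>2 + (w t)\<^sup>2)"
  have "((\<lambda>t. (f t)\<^sup>2 * w t) has_real_derivative ?d t) (at t)" if "t \<in> {p..q}" for t
    by (rule derivative_eq_intros f dw[OF that] refl)+ (simp add: algebra_simps)
  then have "(?d has_integral ((f q)\<^sup>2 * w q - (f p)\<^sup>2 * w p)) {p..q}"
    by (intro fundamental_theorem_of_calculus \<open>p \<le> q\<close>)
       (auto simp flip: has_real_derivative_iff_has_vector_derivative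
             intro: has_field_derivative_at_within)
  then have int_d: "(?d has_integral 0) {p..q}"
    using assms by simp
  have cf: "continuous_on UNIV f"
    using f by (meson DERIV_isCont continuous_at_imp_continuous_on)
  have i1: "(\<lambda>t. (f' t)\<^sup>2) integrable_on {p..q}" and i2: "(\<lambda>t. (f t)\<^sup>2) integrable_on {p..q}"
    by (intro integrable_continuous_real continuous_intros
        continuous_on_subset[OF f'] continuous_on_subset[OF cf] subset_UNIV)+
  have "((\<lambda>t. (f' t)\<^sup>2 - \<omega>\<^sup>2 * (f t)\<^sup>2) has_integral
      (integral {p..q} (\<lambda>t. (f' t)\<^sup>2) - \<omega>\<^sup>2 * integral {p..q} (\<lambda>t. (f t)\<^sup>2))) {p..q}"
    by (intro has_integral_diff has_integral_mult_right integrable_integral i1 i2)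
  moreover have "?d t \<le> (f' t)\<^sup>2 - \<omega>\<^sup>2 * (f t)\<^sup>2" for t
    using zero_le_power2[of "f' t - f t * w t"] by (simp add: power2_eq_square algebra_simps)
  ultimately have "0 \<le> integral {p..q} (\<lambda>t. (f' t)\<^sup>2) - \<omega>\<^sup>2 * integral {p..q} (\<lambda>t. (f t)\<^sup>2)"
    using has_integral_le[OF int_d] by blast
  then show ?thesis by simp
qed

section \<open>Antiderivatives and integrals of periodic functions\<close>

lemma ex_antiderivative:
  fixes h :: "real \<Rightarrow> real"
  assumes "continuous_on UNIV h"
  shows "\<exists>H. \<forall>t. (H has_real_derivative h t) (at t)"
  using einterval_antiderivative[of "-\<infinity>" \<infinity> h] assms
  by (simp add: continuous_on_eq_continuous_at has_real_derivative_iff_has_vector_derivative)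

text \<open>The increment over one period has derivative h (t + T) - h t = 0. This yields both the
  shift invariance of integrals over a period and the zero mean of
  \<open>v (t + h) - v t\<close>.\<close>

lemma antiderivative_periodic_increment:
  fixes h :: "real \<Rightarrow> real"
  assumes H: "\<And>t. (H has_real_derivative h t) (at t)" and p: "\<And>t. h (t + T) = h t"
  shows "H (t + T) - H t = H (s + T) - H s"
proof (rule DERIV_isconst_all[rule_format, of "\<lambda>t. H (t + T) - H t"])
  show "((\<lambda>t. H (t + T) - H t) has_real_derivative 0) (at t)" for t
    using DERIV_diff[OF H[of "t + T", unfolded DERIV_shift] H[of t]] p by simp
qed

lemma integral_eq_antiderivative:
  fixes h :: "real \<Rightarrow> real"
  assumes "\<And>t. (H has_real_derivative h t) (at t)" "p \<le> q"
  shows "integral {p..q} h = H q - H p"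
  using assms
  by (intro integral_unique fundamental_theorem_of_calculus)
     (auto simp flip: has_real_derivative_iff_has_vector_derivative
           intro: has_field_derivative_at_within)

lemma integral_periodic_shift:
  fixes h :: "real \<Rightarrow> real"
  assumes "continuous_on UNIV h" "\<And>t. h (t + T) = h t" "T \<ge> 0"
  shows "integral {c..c + T} h = integral {0..T} h"
proof -
  obtain H where H: "\<And>t. (H has_real_derivative h t) (at t)"
    using ex_antiderivative[OF assms(1)] by blast
  show ?thesis
    using integral_eq_antiderivative[OF H, of c "c + T"] integral_eq_antiderivative[OF H, of 0 T]
      antiderivative_periodic_increment[OF H assms(2), of c 0] \<open>T \<ge> 0\<close> by simp
qed

lemma wirtinger_periodic:
  fixes f f' :: "real \<Rightarrow> real"
  assumes "T > 0" "0 < \<omega>" "\<omega> * T < 2 * pi"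
    and f: "\<And>t. (f has_real_derivative f' t) (at t)"
    and f': "continuous_on UNIV f'"
    and per: "\<And>t. f (t + T) = f t" "\<And>t. f' (t + T) = f' t"
    and mean: "integral {0..T} f = 0"
  shows "\<omega>\<^sup>2 * integral {0..T} (\<lambda>t. (f t)\<^sup>2) \<le> integral {0..T} (\<lambda>t. (f' t)\<^sup>2)"
proof -
  have cf: "continuous_on UNIV f"
    using f by (meson DERIV_isCont continuous_at_imp_continuous_on)
  note c_intros = continuous_intros continuous_on_subset[OF cf] continuous_on_subset[OF f']
  text \<open>Subtracting the common value of \<open>f\<close> at two points half a period apart reduces the
    periodic case to two intervals with Dirichlet boundary conditions.\<close>
  obtain c where c: "f c = f (c + T/2)"
  proof -
    define d where "d t = f t - f (t + T/2)" for t
    \<comment> \<open>By periodicity \<open>d\<close> takes opposite values at the ends of [0, T/2],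
      so the intermediate value theorem gives a zero whichever sign \<open>d 0\<close> has.\<close>
    have "d (T/2) = - d 0"
      using per(1)[of 0] by (simp add: d_def)
    moreover have "continuous_on {0..T/2} d"
      unfolding d_def by (intro continuous_intros continuous_on_subset[OF cf]
          continuous_on_compose2[OF cf]) auto
    ultimately have "\<exists>c. 0 \<le> c \<and> c \<le> T/2 \<and> d c = 0"
      using IVT'[of d 0 0 "T/2"] IVT2'[of d "T/2" 0 0] \<open>T > 0\<close> by (cases "d 0 \<le> 0") auto
    then show thesis using that by (auto simp: d_def)
  qed
  define e where "e t = f t - f c" for t
  have e: "(e has_real_derivative f' t) (at t)" for t
    unfolding e_def using DERIV_diff[OF f DERIV_const] by simp
  have e0: "e c = 0" "e (c + T/2) = 0" "e (c + T) = 0"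
    using c per by (simp_all add: e_def)
  have "\<omega> * (T/2) < pi" using assms by simp
  then have half: "\<omega>\<^sup>2 * integral {c..c + T/2} (\<lambda>t. (e t)\<^sup>2) \<le> integral {c..c + T/2} (\<lambda>t. (f' t)\<^sup>2)"
    "\<omega>\<^sup>2 * integral {c + T/2..c + T} (\<lambda>t. (e t)\<^sup>2) \<le> integral {c + T/2..c + T} (\<lambda>t. (f' t)\<^sup>2)"
    using \<open>T > 0\<close> \<open>0 < \<omega>\<close> by (intro wirtinger_Dirichlet e f' e0; simp)+
  have ce: "continuous_on UNIV (\<lambda>t. (e t)\<^sup>2)" "continuous_on UNIV (\<lambda>t. (f' t)\<^sup>2)"
    unfolding e_def by (intro c_intros subset_UNIV)+
  have comb: "integral {c..c + T/2} h + integral {c + T/2..c + T} h = integral {0..T} h"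
    if "continuous_on UNIV h" "\<And>t. h (t + T) = h t" for h :: "real \<Rightarrow> real"
  proof -
    have "integral {c..c + T/2} h + integral {c + T/2..c + T} h = integral {c..c + T} h"
      using \<open>T > 0\<close> that
      by (intro Henstock_Kurzweil_Integration.integral_combine integrable_continuous_real)
         (auto intro: continuous_on_subset)
    then show ?thesis using integral_periodic_shift[OF that] \<open>T > 0\<close> by simp
  qed
  have "\<omega>\<^sup>2 * integral {0..T} (\<lambda>t. (e t)\<^sup>2) \<le> integral {0..T} (\<lambda>t. (f' t)\<^sup>2)"
    using add_mono[OF half] comb[OF ce(1)] comb[OF ce(2)] per
    by (simp add: e_def flip: distrib_left)
  \<comment> \<open>Here the zero mean enters: the cross term in (f - f c)^2 integrates to 0, so
    subtracting the constant adds T * (f c)^2 to the integral of the square.\<close>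
  moreover have "integral {0..T} (\<lambda>t. (f t)\<^sup>2) \<le> integral {0..T} (\<lambda>t. (e t)\<^sup>2)"
  proof -
    have i: "((\<lambda>t. (f t)\<^sup>2) has_integral integral {0..T} (\<lambda>t. (f t)\<^sup>2)) {0..T}"
      "(f has_integral 0) {0..T}"
      using mean integrable_integral[of f "{0..T}"]
      by (auto intro!: integrable_integral integrable_continuous_real c_intros)
    have k: "((\<lambda>t. (f c)\<^sup>2) has_integral T * (f c)\<^sup>2) {0..T}"
      using has_integral_const_real[of "(f c)\<^sup>2" 0 T] \<open>T > 0\<close> by simp
    have "((\<lambda>t. (f t)\<^sup>2 - 2 * f c * f t + (f c)\<^sup>2) has_integral
        integral {0..T} (\<lambda>t. (f t)\<^sup>2) - 2 * f c * 0 + T * (f c)\<^sup>2) {0..T}"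
      by (intro has_integral_add has_integral_diff has_integral_mult_right i k)
    then have "integral {0..T} (\<lambda>t. (e t)\<^sup>2) = integral {0..T} (\<lambda>t. (f t)\<^sup>2) + T * (f c)\<^sup>2"
      by (intro integral_unique) (simp add: e_def power2_diff algebra_simps)
    then show ?thesis using \<open>T > 0\<close> by simp
  qed
  ultimately show ?thesis
    by (meson mult_left_mono order_trans zero_le_power2)
qed


section \<open>Yorke's lower bound for the period\<close>

text \<open>Wirtinger bounds the integral of |y'|^2 below by \<omega>^2 times that of |y|^2, the
  Lipschitz bound puts it below L^2 times the same integral, and L < \<omega> leaves only y = 0.
  Taking differences y of shifted solutions serves both sides: it removes the mean, and it is what a
  Lipschitz bound can estimate.\<close>

theorem Yorke_constant:
  fixes v :: "real \<Rightarrow> nat \<Rightarrow> real"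
  assumes "T > 0" and L: "Lipschitz_bound n F L" "L * T < 2 * pi"
    and dv: "\<And>t i. i < n \<Longrightarrow> ((\<lambda>t. v t i) has_real_derivative F (v t) i) (at t)"
    and cF: "\<And>i. i < n \<Longrightarrow> continuous_on UNIV (\<lambda>t. F (v t) i)"
    and per: "\<And>t i. i < n \<Longrightarrow> v (t + T) i = v t i"
    and "i < n"
  shows "v h i = v 0 i"
proof -
  have "L \<ge> 0" using L(1) by (simp add: Lipschitz_bound_def)
  \<comment> \<open>Room on both sides: \<omega> * T < 2 * pi admits Wirtinger, L < \<omega> makes
    the final comparison strict. It also keeps \<omega> positive when L = 0.\<close>
  obtain \<omega> where \<omega>: "L < \<omega>" "\<omega> < 2 * pi / T"
    using L(2) \<open>T > 0\<close> dense[of L "2 * pi / T"] by (auto simp: field_simps)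
  then have \<omega>': "0 < \<omega>" "\<omega> * T < 2 * pi"
    using \<open>L \<ge> 0\<close> \<open>T > 0\<close> by (auto simp: field_simps)
  define y where "y i t = v (t + h) i - v t i" for i t
  define y' where "y' i t = F (v (t + h)) i - F (v t) i" for i t
  \<comment> \<open>The functions \<open>v (t + T)\<close> and \<open>v t\<close> agree only at
    indices below \<open>n\<close>, so \<open>F\<close> cannot simply be applied to an equality; the
    claim follows from uniqueness of the derivative of a periodic component.\<close>
  have perF: "F (v (t + T)) i = F (v t) i" if "i < n" for i t
  proof -
    have "((\<lambda>s. v (s + T) i) has_real_derivative F (v (t + T)) i) (at t)"
      using dv[OF that, of "t + T"] unfolding DERIV_shift .
    then show ?thesis
      using dv[OF that, of t] DERIV_unique unfolding per[OF that] by blast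
  qed
  have cv: "continuous_on UNIV (\<lambda>t. v t i)" if "i < n" for i
    using dv[OF that] by (meson DERIV_isCont continuous_at_imp_continuous_on)
  have y: "(y i has_real_derivative y' i t) (at t)" if "i < n" for i t
    unfolding y_def y'_def
    by (intro DERIV_diff dv that dv[OF that, of "t + h", unfolded DERIV_shift])
  have cy': "continuous_on UNIV (y' i)" if "i < n" for i
    unfolding y'_def
    by (intro continuous_intros cF that continuous_on_compose2[OF cF[OF that]]) auto
  have cy: "continuous_on UNIV (y i)" if "i < n" for i
    using y[OF that] by (meson DERIV_isCont continuous_at_imp_continuous_on)
  have py: "y i (t + T) = y i t" "y' i (t + T) = y' i t" if "i < n" for i t
    using per[OF that, of "t + h"] per[OF that, of t] perF[OF that, of "t + h"] perF[OF that, of t]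
    by (simp_all add: y_def y'_def algebra_simps)
  have mean: "integral {0..T} (y i) = 0" if "i < n" for i
  proof -
    from ex_antiderivative[OF cv[OF that]]
    obtain V where V: "\<And>t. (V has_real_derivative v t i) (at t)" by blast
    have "((\<lambda>t. V (t + h) - V t) has_real_derivative y i t) (at t)" for t
      unfolding y_def by (intro DERIV_diff V V[of "t + h", unfolded DERIV_shift])
    then have "integral {0..T} (y i) = (V (T + h) - V T) - (V (0 + h) - V 0)"
      using \<open>T > 0\<close> by (intro integral_eq_antiderivative) auto
    moreover have "V (h + T) - V h = V (0 + T) - V 0"
      using V per[OF that] by (rule antiderivative_periodic_increment)
    ultimately show ?thesis by (simp add: add.commute)
  qed
  define Y where "Y = (\<lambda>t. \<Sum>i<n. (y i t)\<^sup>2)"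
  have int: "(\<lambda>t. (y i t)\<^sup>2) integrable_on {0..T}" "(\<lambda>t. (y' i t)\<^sup>2) integrable_on {0..T}"
    if "i < n" for i
    by (intro integrable_continuous_real continuous_intros continuous_on_subset[OF cy[OF that]]
        continuous_on_subset[OF cy'[OF that]] subset_UNIV)+
  have cY: "continuous_on {0..T} Y"
    unfolding Y_def by (intro continuous_intros continuous_on_subset[OF cy]) auto
  have "\<omega>\<^sup>2 * integral {0..T} Y = (\<Sum>i<n. \<omega>\<^sup>2 * integral {0..T} (\<lambda>t. (y i t)\<^sup>2))"
    unfolding Y_def by (subst integral_sum) (auto simp: int sum_distrib_left)
  \<comment> \<open>Wirtinger holds in each component with the same \<omega>; the sum over
    components is the squared Euclidean norm, the one in which \<open>L\<close> is measured.\<close>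
  also have "\<dots> \<le> (\<Sum>i<n. integral {0..T} (\<lambda>t. (y' i t)\<^sup>2))"
    by (intro sum_mono wirtinger_periodic[OF \<open>T > 0\<close> \<omega>'] y cy' py mean) auto
  also have "\<dots> = integral {0..T} (\<lambda>t. \<Sum>i<n. (y' i t)\<^sup>2)"
    by (subst integral_sum) (auto simp: int)
  also have "\<dots> \<le> integral {0..T} (\<lambda>t. L\<^sup>2 * Y t)"
  proof (rule integral_le)
    show "(\<lambda>t. \<Sum>i<n. (y' i t)\<^sup>2) integrable_on {0..T}"
      by (intro integrable_sum) (auto simp: int)
    show "(\<lambda>t. L\<^sup>2 * Y t) integrable_on {0..T}"
      by (intro integrable_continuous_real continuous_intros cY)
    show "(\<Sum>i<n. (y' i t)\<^sup>2) \<le> L\<^sup>2 * Y t" for t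
    proof -
      have "L2_set (\<lambda>i. y' i t) {..<n} \<le> L * L2_set (\<lambda>i. y i t) {..<n}"
        using L(1) unfolding Lipschitz_bound_def y_def y'_def by blast
      then have "(L2_set (\<lambda>i. y' i t) {..<n})\<^sup>2 \<le> (L * L2_set (\<lambda>i. y i t) {..<n})\<^sup>2"
        by (intro power_mono) auto
      then show ?thesis
        by (simp add: Y_def L2_set_def power_mult_distrib sum_nonneg)
    qed
  qed
  also have "\<dots> = L\<^sup>2 * integral {0..T} Y" by simp
  finally have "(\<omega>\<^sup>2 - L\<^sup>2) * integral {0..T} Y \<le> 0" by (simp add: left_diff_distrib)
  moreover have "\<omega>\<^sup>2 - L\<^sup>2 > 0" using \<omega>(1) \<open>L \<ge> 0\<close> by (simp add: power_strict_mono)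
  ultimately have "integral {0..T} Y \<le> 0" by (simp add: mult_le_0_iff)
  moreover have Y0: "Y t \<ge> 0" for t unfolding Y_def by (intro sum_nonneg) auto
  then have "integral {0..T} Y \<ge> 0" by (intro integral_nonneg integrable_continuous_real cY)
  \<comment> \<open>A continuous nonnegative function with zero integral vanishes on the whole
    interval; its value at 0 compares \<open>v h\<close> with \<open>v 0\<close>.\<close>
  ultimately have "Y 0 = 0"
    using integral_eq_0_iff[OF cY \<open>T > 0\<close>] Y0 \<open>T > 0\<close> by auto
  then have "y i 0 = 0"
    using \<open>i < n\<close> by (simp add: Y_def sum_nonneg_eq_0_iff)
  then show ?thesis by (simp add: y_def)
qed


section \<open>The linear chain trick\<close>

text \<open>With H' = a * exp (a * t) * h, the solutions of V' = a * (h - V) are exp (- a * t) * (H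
  + C). Periodicity forces C = (H (t + T) - E * H t) / (E - 1) with E = exp (a * T), and inserting
  this C gives the formula chosen for \<open>V\<close>.\<close>

lemma ex_periodic_relaxation:
  fixes h :: "real \<Rightarrow> real"
  assumes "a > 0" "T > 0" and ch: "continuous_on UNIV h" and per: "\<And>t. h (t + T) = h t"
  shows "\<exists>V. (\<forall>t. (V has_real_derivative a * (h t - V t)) (at t)) \<and> (\<forall>t. V (t + T) = V t)"
proof -
  have "continuous_on UNIV (\<lambda>t. a * exp (a * t) * h t)"
    by (intro continuous_intros ch)
  then obtain H where H: "\<And>t. (H has_real_derivative a * exp (a * t) * h t) (at t)"
    using ex_antiderivative by blast
  define E where "E = exp (a * T)"
  have "E > 1" using assms by (simp add: E_def)
  define V where "V t = exp (- (a * t)) * (H (t + T) - H t) / (E - 1)" for t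
  have HT: "((\<lambda>t. H (t + T)) has_real_derivative E * (a * exp (a * t) * h t)) (at t)" for t
    using H[of "t + T", unfolded DERIV_shift]
    by (simp add: per E_def distrib_left exp_add mult_ac)
  have "(V has_real_derivative a * (h t - V t)) (at t)" for t
  proof -
    have "((\<lambda>t. exp (- (a * t))) has_real_derivative - a * exp (- (a * t))) (at t)"
      by (auto intro!: derivative_eq_intros)
    from DERIV_mult[OF this DERIV_diff[OF HT H]]
    have "(V has_real_derivative (- a * exp (- (a * t)) * (H (t + T) - H t) +
        (E * (a * exp (a * t) * h t) - a * exp (a * t) * h t) * exp (- (a * t))) / (E - 1)) (at t)"
      unfolding V_def by (rule DERIV_cdivide)
    moreover have "(E * (a * exp (a * t) * h t) - a * exp (a * t) * h t) * exp (- (a * t))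
        = (E - 1) * (a * h t)"
      by (simp add: exp_minus field_simps)
    moreover have "(- a * e * d + (E - 1) * c) / (E - 1) = c - a * (e * d / (E - 1))" for e d c
      using \<open>E > 1\<close> by (simp add: divide_simps)
    ultimately show ?thesis
      unfolding V_def right_diff_distrib[of a] by (simp only:)
  qed
  moreover have "V (t + T) = V t" for t
  proof -
    \<comment> \<open>Over one period the derivative of \<open>H\<close> is multiplied by
      \<open>E\<close>, so H (t + T) - E * H t is constant: the integration constant C is well
      defined.\<close>
    have "H (t + T + T) - E * H (t + T) = H (t + T) - E * H t"
    proof (rule DERIV_isconst_all[rule_format, of "\<lambda>t. H (t + T) - E * H t"])
      show "((\<lambda>t. H (t + T) - E * H t) has_real_derivative 0) (at t)" for t
        using DERIV_diff[OF HT DERIV_cmult[OF H, of E]] by simp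
    qed
    then have *: "H (t + T + T) - H (t + T) = E * (H (t + T) - H t)"
      by (simp add: algebra_simps)
    have "exp (- (a * (t + T))) * E = exp (- (a * t))"
      by (simp add: E_def distrib_left flip: exp_add)
    then show ?thesis
      unfolding V_def * by (metis mult.assoc)
  qed
  ultimately show ?thesis by blast
qed

text \<open>Solving the relaxation equation repeatedly gives the components of the chain directly as
  periodic solutions of the differential equations, so no improper integral has to be
  differentiated. Their link with the gamma kernel is established afterwards.\<close>

lemma ex_periodic_chain:
  fixes h :: "real \<Rightarrow> real"
  assumes "a > 0" "T > 0" "continuous_on UNIV h" "\<And>t. h (t + T) = h t"
  obtains V :: "nat \<Rightarrow> real \<Rightarrow> real" where "V 0 = h"
    "\<And>i. continuous_on UNIV (V i)" "\<And>i t. V i (t + T) = V i t"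
    "\<And>i t. (V (Suc i) has_real_derivative a * (V i t - V (Suc i) t)) (at t)"
proof -
  \<comment> \<open>The invariant for dependent choice: \<open>h\<close> is prescribed at index 0
    only, while continuity and periodicity are what the next relaxation step consumes.\<close>
  define P where "P n x \<longleftrightarrow> (n = 0 \<longrightarrow> x = h) \<and> continuous_on UNIV x \<and> (\<forall>t. x (t + T) = x t)"
    for n :: nat and x :: "real \<Rightarrow> real"
  define Q where "Q n x y \<longleftrightarrow> (\<forall>t. (y has_real_derivative a * (x t - y t)) (at t))"
    for n :: nat and x y :: "real \<Rightarrow> real"
  have "\<exists>V. \<forall>n. P n (V n) \<and> Q n (V n) (V (Suc n))"
  proof (rule dependent_nat_choice)
    show "\<exists>x. P 0 x" using assms by (auto simp: P_def)
    show "\<exists>y. P (Suc n) y \<and> Q n x y" if "P n x" for x n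
    proof -
      obtain y where y: "\<And>t. (y has_real_derivative a * (x t - y t)) (at t)"
        "\<And>t. y (t + T) = y t"
        using ex_periodic_relaxation[OF assms(1,2), of x] \<open>P n x\<close> by (auto simp: P_def)
      then have "continuous_on UNIV y"
        by (meson DERIV_isCont continuous_at_imp_continuous_on)
      with y show ?thesis by (auto simp: P_def Q_def)
    qed
  qed
  then obtain V where "\<And>n. P n (V n)" "\<And>n. Q n (V n) (V (Suc n))" by blast
  then show thesis using that[of V] by (simp add: P_def Q_def)
qed

lemma integrable_gamma_density:
  assumes "a > 0" "b \<ge> 1"
  shows "integrable lborel (gamma_density a b)"
proof -
  have "(\<integral>\<^sup>+ x. ennreal (erlang_density (b - 1) a x) \<partial>lborel) = 1"
    using nn_integral_erlang_ith_moment[OF \<open>a > 0\<close>, of "b - 1" 0] by simp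
  then show ?thesis
    unfolding gamma_density_eq_erlang[OF \<open>b \<ge> 1\<close>]
    using \<open>a > 0\<close> by (intro integrableI_nonneg) auto
qed

text \<open>The integrand has an explicit antiderivative \<open>F\<close>, built from the chain and
  gamma-type kernels of lower order. It decays at minus infinity and equals \<open>V b t\<close> at
  the end point, so the fundamental theorem of calculus gives the integral.\<close>

lemma gamma_convolution_eq_chain:
  fixes V :: "nat \<Rightarrow> real \<Rightarrow> real"
  assumes "a > 0" "b \<ge> 1" "T > 0"
    and cV: "\<And>i. continuous_on UNIV (V i)" and pV: "\<And>i t. V i (t + T) = V i t"
    and dV: "\<And>i t. (V (Suc i) has_real_derivative a * (V i t - V (Suc i) t)) (at t)"
  shows "(LINT s:{..t}|lborel. gamma_density a b (t - s) * V 0 s) = V b t"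
proof -
  have "\<exists>M. \<forall>s. \<bar>V i s\<bar> \<le> M" for i
    using periodic_bounded_real[OF \<open>T > 0\<close> cV pV] by (auto simp: bdd_above_def)
  then obtain M where M: "\<And>i s. \<bar>V i s\<bar> \<le> M i" by metis
  \<comment> \<open>Poisson weights of parameter a * (t - s): \<open>a * p (b - 1)\<close> is the
    gamma kernel for s \<le> t. The shifted \<open>q\<close> sets the weight of index -1 to 0, so
    one derivative rule covers every \<open>i\<close>.\<close>
  define p where "p i s = (a * (t - s)) ^ i * exp (- (a * (t - s))) / fact i" for i s
  define q where "q i s = (if i = 0 then 0 else p (i - 1) s)" for i s
  have dp: "(p i has_real_derivative a * (p i s - q i s)) (at s)" for i s
  proof (cases i)
    case 0
    show ?thesis unfolding p_def q_def 0
      by (auto intro!: derivative_eq_intros)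
  next
    case (Suc j)
    show ?thesis unfolding p_def q_def Suc
      apply (rule derivative_eq_intros refl | simp)+
      apply (simp add: divide_simps del: fact_Suc)
      apply (simp add: algebra_simps)
      done
  qed
  text \<open>The summand indices of kernel and chain add up to \<open>b\<close>, so that the derivative of the sum
    telescopes.\<close>
  define F where "F s = (\<Sum>i<b. p i s * V (b - i) s)" for s
  have gam: "gamma_density a b (t - s) = a * p (b - 1) s" if "s \<le> t" for s
    using that \<open>b \<ge> 1\<close>
    by (cases b) (auto simp: gamma_density_def p_def power_mult_distrib)
  have dF: "(F has_real_derivative a * p (b - 1) s * V 0 s) (at s)" for s
  proof -
    let ?f = "\<lambda>i. a * q i s * V (b - i) s"
    have "((\<lambda>s. p i s * V (b - i) s) has_real_derivative ?f (Suc i) - ?f i) (at s)"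
      if "i < b" for i
    proof -
      have b: "b - i = Suc (b - Suc i)" using that by simp
      show ?thesis
        unfolding b by (rule derivative_eq_intros dp dV refl)+ (simp add: q_def algebra_simps)
    qed
    then have "(F has_real_derivative (\<Sum>i<b. ?f (Suc i) - ?f i)) (at s)"
      unfolding F_def by (intro DERIV_sum) auto
    moreover have "(\<Sum>i<b. ?f (Suc i) - ?f i) = a * p (b - 1) s * V 0 s"
      using \<open>b \<ge> 1\<close> by (subst sum_lessThan_telescope) (simp add: q_def)
    ultimately show ?thesis by simp
  qed
  have p_lim: "(p i \<longlongrightarrow> 0) at_bot" for i
  proof -
    have "LIM s at_bot. t - s :> at_top"
      by real_asymp
    then have "LIM s at_bot. a * (t - s) :> at_top"
      by (rule filterlim_tendsto_pos_mult_at_top[OF tendsto_const \<open>a > 0\<close>])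
    from filterlim_compose[OF tendsto_power_div_exp_0 this]
    have "((\<lambda>s. (a * (t - s)) ^ i / exp (a * (t - s)) / fact i) \<longlongrightarrow> 0 / fact i) at_bot"
      by (intro tendsto_divide tendsto_const) auto
    moreover have "p i = (\<lambda>s. (a * (t - s)) ^ i / exp (a * (t - s)) / fact i)"
      unfolding p_def exp_minus by (rule ext) (simp only: divide_inverse mult_ac)
    ultimately show ?thesis by simp
  qed
  have F_lim: "(F \<longlongrightarrow> 0) at_bot"
    unfolding F_def
  proof (rule tendsto_null_sum)
    show "((\<lambda>s. p i s * V (b - i) s) \<longlongrightarrow> 0) at_bot" for i
      by (rule tendsto_0_le[OF p_lim[of i], where K = "M (b - i)"])
         (use M in \<open>auto simp: abs_mult intro!: always_eventually mult_left_mono\<close>)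
  qed
  \<comment> \<open>At s = t every weight with i > 0 vanishes and the weight of index 0 is
    1.\<close>
  have "F t = V b t"
  proof -
    have "F t = (\<Sum>i<b. if i = 0 then V b t else 0)"
      unfolding F_def p_def by (intro sum.cong) auto
    then show ?thesis using \<open>b \<ge> 1\<close> by simp
  qed
  \<comment> \<open>The integrand may change sign, so integrability is supplied by domination: the
    density times a bound for the periodic function \<open>V 0\<close>.\<close>
  have int: "integrable lborel (\<lambda>s. gamma_density a b (t - s) * V 0 s)"
  proof (rule Bochner_Integration.integrable_bound)
    show "integrable lborel (\<lambda>s. M 0 * gamma_density a b (t - s))"
      using lborel_integrable_real_affine[OF integrable_gamma_density[OF assms(1,2)], of "-1" t]
      by simp
    have "V 0 \<in> borel_measurable borel" using cV by (rule borel_measurable_continuous_onI)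
    moreover have "(\<lambda>s. gamma_density a b (t - s)) \<in> borel_measurable borel"
      unfolding gamma_density_def by measurable
    ultimately show "(\<lambda>s. gamma_density a b (t - s) * V 0 s) \<in> borel_measurable lborel"
      by measurable
    have "\<bar>gamma_density a b (t - s) * V 0 s\<bar> \<le> \<bar>M 0 * gamma_density a b (t - s)\<bar>" for s
      using M[of 0 s] by (simp add: abs_mult mult.commute mult_right_mono)
    then show "AE s in lborel. norm (gamma_density a b (t - s) * V 0 s)
        \<le> norm (M 0 * gamma_density a b (t - s))" by simp
  qed
  let ?k = "\<lambda>s. gamma_density a b (t - s) * V 0 s"
  \<comment> \<open>Interval integrals run over open intervals, so the end point, a null set, is
    dropped first.\<close>
  have "(LINT s:{..t}|lborel. ?k s) = (LINT s:{..<t}|lborel. ?k s)"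
  proof (rule set_integral_null_delta[OF int])
    have "{..t} - {..<t} \<union> ({..<t} - {..t}) = {t}" by auto
    then show "{..t} - {..<t} \<union> ({..<t} - {..t}) \<in> null_sets lborel" by (simp add: null_sets_def)
  qed auto
  also have "\<dots> = (LINT s:{..<t}|lborel. a * p (b - 1) s * V 0 s)"
    by (intro set_lebesgue_integral_cong) (auto simp: gam)
  also have "\<dots> = (LBINT s=-\<infinity>..t. a * p (b - 1) s * V 0 s)"
    by (simp add: interval_lebesgue_integral_def einterval_eq_Iic)
  also have "\<dots> = V b t - 0"
  proof (rule interval_integral_FTC_integrable[where F = F])
    show "(F has_vector_derivative a * p (b - 1) s * V 0 s) (at s)" for s
      using dF by (simp add: has_real_derivative_iff_has_vector_derivative)
    have "isCont (V 0) s" for s using cV[of 0] by (simp add: continuous_on_eq_continuous_at)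
    then show "isCont (\<lambda>s. a * p (b - 1) s * V 0 s) s" for s
      unfolding p_def by (intro continuous_intros) auto
    have "set_integrable lborel {..<t} ?k"
      unfolding set_integrable_def using int by (intro integrable_mult_indicator) auto
    then show "set_integrable lborel (einterval (-\<infinity>) (ereal t)) (\<lambda>s. a * p (b - 1) s * V 0 s)"
      unfolding einterval_eq_Iic by (rule set_integrable_cong[THEN iffD1, rotated -1]) (auto simp: gam)
    show "((F \<circ> real_of_ereal) \<longlongrightarrow> 0) (at_right (-\<infinity>))"
      unfolding ereal_tendsto_simps by (rule F_lim)
    have "isCont F t" using dF by (rule DERIV_isCont)
    then have "(F \<longlongrightarrow> F t) (at_left t)"
      by (metis continuous_at_imp_continuous_within continuous_within)
    then show "((F \<circ> real_of_ereal) \<longlongrightarrow> V b t) (at_left (ereal t))"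
      unfolding ereal_tendsto_simps \<open>F t = V b t\<close> .
  qed simp
  finally show ?thesis by simp
qed


section \<open>Unforced periodic solutions\<close>

theorem unforced_periodic_solution_constant:
  assumes "a > 0" "b \<ge> 1" "T > 0"
    and g: "\<exists>C. C-lipschitz_on UNIV g" and phi: "\<exists>C. C-lipschitz_on UNIV \<phi>"
    and T: "T < 2 * pi / Lipschitz_constant (b + 2) (G_map a b g \<phi>)"
    and sol: "periodic_solution a b g \<phi> f T 0 x"
  shows "x t = x 0"
proof -
  let ?G = "G_map a b g \<phi>"
  \<comment> \<open>The infimum need not be shown to be attained: any admissible \<open>L\<close>
    below 2 * pi / T suffices.\<close>
  obtain L where L: "Lipschitz_bound (b + 2) ?G L" "L * T < 2 * pi"
  proof -
    let ?S = "{L. Lipschitz_bound (b + 2) ?G L}"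
    have ne: "?S \<noteq> {}" using G_map_Lipschitz[OF g phi] by auto
    then have "Inf ?S \<ge> 0" by (intro cInf_greatest) (auto simp: Lipschitz_bound_def)
    \<comment> \<open>Division by 0 yields 0, so a vanishing Lipschitz constant would turn the bound
      on \<open>T\<close> into T < 0.\<close>
    moreover have "Inf ?S \<noteq> 0"
      using T \<open>T > 0\<close> unfolding Lipschitz_constant_def by auto
    ultimately have "Inf ?S < 2 * pi / T"
      using T \<open>T > 0\<close> by (simp add: Lipschitz_constant_def field_simps)
    then obtain L where "L \<in> ?S" "L < 2 * pi / T" using cInf_lessD[OF ne] by blast
    then show thesis using that \<open>T > 0\<close> by (simp add: field_simps)
  qed
  have x: "x \<in> C1_T T" and x': "deriv x \<in> C1_T T"
  proof -
    show "x \<in> C1_T T" using sol by (auto simp: C1_T_def periodic_solution_def)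
    from C1_T_D(5)[OF this] show "deriv x \<in> C1_T T"
      using sol by (auto simp: C1_T_def periodic_solution_def)
  qed
  define h where "h s = \<phi> (x s, deriv x s)" for s
  have "continuous_on UNIV \<phi>" using phi lipschitz_on_continuous_on by blast
  then have "continuous_on UNIV h"
    unfolding h_def
    by (rule continuous_on_compose2) (auto intro!: continuous_intros C1_T_D[OF x])
  moreover have "h (s + T) = h s" for s
    by (simp add: h_def C1_T_D(4,5)[OF x])
  ultimately obtain V where V: "V 0 = h" "\<And>i. continuous_on UNIV (V i)"
    "\<And>i t. V i (t + T) = V i t"
    "\<And>i t. (V (Suc i) has_real_derivative a * (V i t - V (Suc i) t)) (at t)"
    using ex_periodic_chain[OF assms(1,3)] by metis
  \<comment> \<open>Index \<open>i\<close> carries chain element i - 1, so the last index b + 1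
    holds \<open>V b\<close>, the entry that \<open>G_map\<close> passes to
    \<open>g\<close>.\<close>
  define v where "v s i = (if i = 0 then x s else if i = 1 then deriv x s else V (i - 1) s)" for s i
  have x'': "deriv (deriv x) s = g (x s, deriv x s, V b s)" for s
    using sol gamma_convolution_eq_chain[of a b T V, OF assms(1-3) V(2-4), of s]
    by (simp add: periodic_solution_def V(1) h_def)
  \<comment> \<open>As \<open>V 0\<close> is \<phi> along the solution, the row of index 2 takes the
    same form as the later rows.\<close>
  have Gv: "?G (v s) i = (if i = 0 then deriv x s else if i = 1 then deriv (deriv x) s
      else a * (V (i - 2) s - V (i - 1) s))" for s i
    using \<open>b \<ge> 1\<close> by (auto simp: G_map_def v_def x'' V(1) h_def numeral_2_eq_2)
  have "v t 0 = v 0 0"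
  proof (rule Yorke_constant[OF \<open>T > 0\<close> L])
    show "((\<lambda>t. v t i) has_real_derivative ?G (v t) i) (at t)" for t i
    proof -
      consider "i = 0" | "i = 1" | j where "i = Suc (Suc j)" by (metis One_nat_def not0_implies_Suc)
      then show ?thesis
        using C1_T_D(1)[OF x] C1_T_D(1)[OF x'] V(4) unfolding Gv v_def by cases auto
    qed
    show "continuous_on UNIV (\<lambda>t. ?G (v t) i)" for i
      unfolding Gv using C1_T_D(3)[OF x] C1_T_D(3)[OF x']
      by (cases "i = 0"; cases "i = 1") (auto intro!: continuous_intros V(2))
    show "v (t + T) i = v t i" for t i
      by (simp add: v_def C1_T_D(4)[OF x] C1_T_D(4)[OF x'] V(3))
  qed simp
  then show ?thesis by (simp add: v_def)
qed
theorem corollary5p3: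
  fixes a T \<alpha> \<beta> :: real and b :: nat
    and g f :: "real \<times> real \<times> real \<Rightarrow> real" and \<phi> :: "real \<times> real \<Rightarrow> real"
    and \<Phi> :: "real \<Rightarrow> real" and L_G :: real
    and \<Omega> X \<Gamma> :: "(real \<times> (real \<Rightarrow> real)) set"
  assumes "a > 0" and "b \<ge> 1" and "T > 0"
    and "continuous_on UNIV f" and "\<And>t p q. f (t + T, p, q) = f (t, p, q)"
    and "\<exists>C. C-lipschitz_on UNIV g" and "\<exists>C. C-lipschitz_on UNIV \<phi>"
    and "L_G = Lipschitz_constant (b + 2) (G_map a b g \<phi>)"
    and "\<And>u. \<Phi> u = g (u, 0, \<phi> (u, 0))"
    and "\<alpha> < \<beta>" and "\<Phi> \<alpha> * \<Phi> \<beta> < 0"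
    and "openin (pair_topology T) \<Omega>" and "slice0 \<Omega> = {\<alpha><..<\<beta>}"
    and "X = forced_pairs a b g \<phi> f T"
    and "\<Gamma> \<subseteq> X \<inter> \<Omega>" and "connectedin (pair_topology T) \<Gamma>"
    and "\<And>p. p \<in> \<Gamma> \<Longrightarrow> \<not> trivial_pair p"
    and "\<not> compactin (pair_topology T) (subtopology (pair_topology T) \<Omega> closure_of \<Gamma>)"
    and "(subtopology (pair_topology T) \<Omega> closure_of \<Gamma>) \<inter>
           {(0, \<lambda>t. u) | u. (0, \<lambda>t. u) \<in> \<Omega> \<and> u \<in> {\<alpha><..<\<beta>} \<inter> \<Phi> -` {0}} \<noteq> {}"
    and "T < 2 * pi / L_G"
  shows "\<Gamma> \<inter> ({0} \<times> C1_T T) = {}"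
proof -
  \<comment> \<open>A pair in the slice solves the unforced equation, hence is constant and trivial,
    against the nontriviality of the pairs in \<Gamma>.\<close>
  have False if "(0, x) \<in> \<Gamma>" for x
  proof -
    have "periodic_solution a b g \<phi> f T 0 x"
      using that assms(14,15) by (auto simp: forced_pairs_def)
    then have "x t = x 0" for t
      using assms(1-3,6-8) assms(20) by (intro unforced_periodic_solution_constant) auto
    then have "trivial_pair (0, x)" unfolding trivial_pair_def by auto
    then show False using assms(17) that by blast
  qed
  then show ?thesis by auto
qed

end
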